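(* Let $\varepsilon\in(0,1)$ and $n\in\mathbb{N}$ with $\varepsilon n\ge4$. For every local property $\mathcal{P}$ of sequences $f:[n]\to\mathbb{R}$, the pair tester with parameters $\mathcal{P},\varepsilon$ is a nonadaptive $\varepsilon$-tester for $\mathcal{P}$ with one-sided error in the offline testing model (without erasures or corruptions), with error probability at most $1/7$. That is, it always accepts every $f\in\mathcal{P}$, and it rejects every $f$ that is $\varepsilon$-far from $\mathcal{P}$ with probability at least $6/7$.
   Context: $\log$ is base 2; $[n]=\{1,\dots,n\}$; $[a:b]=\{i\in\mathbb{Z}:a\le i\le b\}$. A property $\mathcal{P}$ of sequences $f:[n]\to\mathbb{R}$ is local if there is a family $\mathcal{F}\subseteq\mathbb{R}^2$ of forbidden pairs such that $f\in\mathcal{P}$ iff $(f(i),f(i+1))\notin\mathcal{F}$ for all $i\in[n-1]$. For $S\subseteq[n]$, $f$ is unrepairable on $S$ (with respect to $\mathcal{P}$) if no $f':[n]\to\mathbb{R}$ that agrees with $f$ on $S$ satisfies $\mathcal{P}$. $f$ is $\varepsilon$-far from $\mathcal{P}$ if at least an $\varepsilon$ fraction of its values must be changed to obtain a sequence in $\mathcal{P}$. Let $D_d(n)=\{(x,y)\in[n]^2: y-x\equiv d\pmod n\}$. Pair tester: set $\ell=\lfloor\log(\varepsilon n/4)\rfloor$. Repeat $\frac{200\log(\varepsilon n)}{\varepsilon}$ times (rounded up to an integer), with independent randomness: sample $i\in[0:\ell]$ uniformly at random, sample $(x,y)\in D_{2^i}(n)$ uniformly at random, query $f(x)$ and $f(y)$,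 and reject if $f$ is unrepairable on $\{x,y\}$. If no iteration rejects, accept. *)

theory Defs
  imports "HOL-Probability.Probability"
begin

text \<open>
  A sequence \<open>f : [n] \<rightarrow> \<real>\<close> is an extensional function on \<open>{1..n}\<close>, so that equality of
  functions is equality of sequences. A property is a set of such sequences.
\<close>

abbreviation seqs :: "nat \<Rightarrow> (nat \<Rightarrow> real) set" where
  "seqs n \<equiv> {1..n} \<rightarrow>\<^sub>E UNIV"

definition local_property :: "nat \<Rightarrow> (nat \<Rightarrow> real) set \<Rightarrow> bool" where
  "local_property n P \<longleftrightarrow> P \<subseteq> seqs n \<and>
     (\<exists>F :: (real \<times> real) set. \<forall>f\<in>seqs n. f \<in> P \<longleftrightarrow> (\<forall>i\<in>{1..n - 1}. (f i, f (i + 1)) \<notin> F))"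

definition unrepairable :: "nat \<Rightarrow> (nat \<Rightarrow> real) set \<Rightarrow> nat set \<Rightarrow> (nat \<Rightarrow> real) \<Rightarrow> bool" where
  "unrepairable n P S f \<longleftrightarrow> \<not> (\<exists>f'\<in>seqs n. (\<forall>x\<in>S. f' x = f x) \<and> f' \<in> P)"

text \<open>If \<open>P\<close> is empty, every sequence is far from it.\<close>

definition eps_far :: "nat \<Rightarrow> real \<Rightarrow> (nat \<Rightarrow> real) set \<Rightarrow> (nat \<Rightarrow> real) \<Rightarrow> bool" where
  "eps_far n \<epsilon> P f \<longleftrightarrow> (\<forall>g\<in>P. real (card {i\<in>{1..n}. f i \<noteq> g i}) \<ge> \<epsilon> * real n)"

text \<open>
  A deterministic, possibly adaptive, query algorithm is a decision tree: \<open>Query x k\<close> asks for the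
  value at \<open>x\<close> and continues with \<open>k a\<close> on answer \<open>a\<close>. A randomized algorithm is a distribution on
  such trees. In the offline model without erasures or corruptions the answer to \<open>x\<close> is \<open>f x\<close>.
\<close>

datatype query_tree = Accept | Reject | Query nat "real \<Rightarrow> query_tree"

primrec accepts :: "query_tree \<Rightarrow> (nat \<Rightarrow> real) \<Rightarrow> bool" where
  "accepts Accept f = True"
| "accepts Reject f = False"
| "accepts (Query x k) f = accepts (k (f x)) f"

primrec queries :: "query_tree \<Rightarrow> (nat \<Rightarrow> real) \<Rightarrow> nat list" where
  "queries Accept f = []"
| "queries Reject f = []"
| "queries (Query x k) f = x # queries (k (f x)) f"

text \<open>Once the random coins are fixed, the queries must not depend on the input.\<close>

definition nonadaptive :: "nat \<Rightarrow> query_tree pmf \<Rightarrow> bool" where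
  "nonadaptive n T \<longleftrightarrow> (\<forall>t\<in>set_pmf T. \<exists>qs. \<forall>f\<in>seqs n. queries t f = qs)"

text \<open>\<open>\<delta>\<close> bounds the error probability; one-sided error means no error on inputs in \<open>P\<close>.\<close>

definition one_sided_tester ::
    "nat \<Rightarrow> real \<Rightarrow> real \<Rightarrow> (nat \<Rightarrow> real) set \<Rightarrow> query_tree pmf \<Rightarrow> bool" where
  "one_sided_tester n \<epsilon> \<delta> P T \<longleftrightarrow>
     (\<forall>t\<in>set_pmf T. \<forall>f\<in>seqs n. set (queries t f) \<subseteq> {1..n}) \<and>
     (\<forall>f\<in>P. \<forall>t\<in>set_pmf T. accepts t f) \<and>
     (\<forall>f\<in>seqs n. eps_far n \<epsilon> P f \<longrightarrow> measure_pmf.prob T {t. \<not> accepts t f} \<ge> 1 - \<delta>)"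

definition cyc_pairs :: "nat \<Rightarrow> nat \<Rightarrow> (nat \<times> nat) set" where
  "cyc_pairs d n = {(x, y). x \<in> {1..n} \<and> y \<in> {1..n} \<and> (int y - int x) mod int n = int d mod int n}"

definition pair_tester_levels :: "real \<Rightarrow> nat \<Rightarrow> nat" where
  "pair_tester_levels \<epsilon> n = nat \<lfloor>log 2 (\<epsilon> * real n / 4)\<rfloor>"

definition pair_tester_rounds :: "real \<Rightarrow> nat \<Rightarrow> nat" where
  "pair_tester_rounds \<epsilon> n = nat \<lceil>200 * log 2 (\<epsilon> * real n) / \<epsilon>\<rceil>"

definition sample_pair :: "real \<Rightarrow> nat \<Rightarrow> (nat \<times> nat) pmf" where
  "sample_pair \<epsilon> n =
     bind_pmf (pmf_of_set {0..pair_tester_levels \<epsilon> n}) (\<lambda>i. pmf_of_set (cyc_pairs (2 ^ i) n))"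

text \<open>
  The flag \<open>rej\<close> records whether some earlier iteration rejected. All sampled pairs are queried
  regardless, and the verdict is given at the end. The algorithm sees only the answers \<open>a, b\<close>;
  unrepairability on \<open>{x, y}\<close> depends on nothing else, so the test is evaluated on
  \<open>undefined(x := a, y := b)\<close>.
\<close>

primrec pair_tester_tree ::
    "nat \<Rightarrow> (nat \<Rightarrow> real) set \<Rightarrow> (nat \<times> nat) list \<Rightarrow> bool \<Rightarrow> query_tree" where
  "pair_tester_tree n P [] rej = (if rej then Reject else Accept)"
| "pair_tester_tree n P (p # ps) rej = (case p of (x, y) \<Rightarrow>
     Query x (\<lambda>a. Query y (\<lambda>b.
       pair_tester_tree n P ps (rej \<or> unrepairable n P {x, y} (undefined(x := a, y := b))))))"

definition pair_tester :: "nat \<Rightarrow> (nat \<Rightarrow> real) set \<Rightarrow> real \<Rightarrow> query_tree pmf" where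
  "pair_tester n P \<epsilon> = map_pmf (\<lambda>ps. pair_tester_tree n P ps False)
     (replicate_pmf (pair_tester_rounds \<epsilon> n) (sample_pair \<epsilon> n))"

end

theory Submission
  imports Defs
begin

text \<open>
  Call the interval \<open>[x, x + 2\<^sup>i]\<close> bad if \<open>f\<close> is unrepairable on its two end points. Cut the
  sequence at some offset into intervals of length \<open>2\<^sup>\<ell>\<close> and subdivide each of them dyadically. If
  no top interval is bad, \<open>f\<close> can be repaired by rewriting, top down, the interiors of the good
  intervals that have a bad child, together with the two incomplete pieces at the ends; so the
  number of changes is at most the total length of the parents of the bad dyadic intervals, plus
  \<open>2 \<cdot> 2\<^sup>\<ell>\<close>. A bad interval of length \<open>2\<^sup>i\<close> appears for only a \<open>2\<^sup>-\<^sup>i\<close> fraction of the offsets, so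
  if fewer than \<open>2\<^sup>\<ell>\<close> intervals are bad in total, some offset gives fewer than
  \<open>4 \<cdot> 2\<^sup>\<ell> \<le> \<epsilon>n\<close> changes. Hence an \<open>\<epsilon>\<close>-far sequence has at least \<open>2\<^sup>\<ell> > \<epsilon>n/8\<close> bad
  intervals, and one iteration rejects with probability at least \<open>\<epsilon> / (8 log (\<epsilon>n))\<close>.
\<close>

section \<open>Segments patched under fixed end values\<close>

definition allowed_on :: "(real \<times> real) set \<Rightarrow> nat \<Rightarrow> nat \<Rightarrow> (nat \<Rightarrow> real) \<Rightarrow> bool" where
  "allowed_on F a b g \<longleftrightarrow> (\<forall>y\<in>{a..<b}. (g y, g (y + 1)) \<notin> F)"

text \<open>Keeping both end values of \<open>f\<close> is what lets patches of adjacent segments be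
  glued; the values of \<open>g\<close> outside \<open>{a..b}\<close> are irrelevant.\<close>

definition patchable :: "(real \<times> real) set \<Rightarrow> (nat \<Rightarrow> real) \<Rightarrow> nat \<Rightarrow> nat \<Rightarrow> nat \<Rightarrow> bool" where
  "patchable F f a b c \<longleftrightarrow> (\<exists>g. g a = f a \<and> g b = f b \<and> allowed_on F a b g \<and>
     card {y\<in>{a..b}. f y \<noteq> g y} \<le> c)"

lemma patchable_refl: "patchable F f a a 0"
  unfolding patchable_def allowed_on_def by (rule exI[of _ f]) auto

lemma patchable_mono: "patchable F f a b c \<Longrightarrow> c \<le> d \<Longrightarrow> patchable F f a b d"
  unfolding patchable_def by (meson le_trans)

lemma allowed_on_join:
  assumes "allowed_on F a b g" "allowed_on F b c h" "g b = h b"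
  shows "allowed_on F a c (\<lambda>y. if y \<le> b then g y else h y)"
  unfolding allowed_on_def
proof
  fix y assume y: "y \<in> {a..<c}"
  consider "y < b" | "y = b" | "y > b" by linarith
  then show "(if y \<le> b then g y else h y, if y + 1 \<le> b then g (y + 1) else h (y + 1)) \<notin> F"
    using y assms unfolding allowed_on_def by cases auto
qed

text \<open>Both patches take the value \<open>f b\<close> at \<open>b\<close>, so gluing creates no
  new adjacent pair, and the changes add up.\<close>

lemma patchable_trans:
  assumes "patchable F f a b c" "patchable F f b d e" "a \<le> b" "b \<le> d"
  shows "patchable F f a d (c + e)"
proof -
  obtain g where g: "g a = f a" "g b = f b" "allowed_on F a b g" "card {y\<in>{a..b}. f y \<noteq> g y} \<le> c"
    using assms(1) unfolding patchable_def by blast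
  obtain h where h: "h b = f b" "h d = f d" "allowed_on F b d h" "card {y\<in>{b..d}. f y \<noteq> h y} \<le> e"
    using assms(2) unfolding patchable_def by blast
  define k where "k = (\<lambda>y. if y \<le> b then g y else h y)"
  have "{y\<in>{a..d}. f y \<noteq> k y} \<subseteq> {y\<in>{a..b}. f y \<noteq> g y} \<union> {y\<in>{b..d}. f y \<noteq> h y}"
    by (auto simp: k_def)
  then have "card {y\<in>{a..d}. f y \<noteq> k y} \<le> card ({y\<in>{a..b}. f y \<noteq> g y} \<union> {y\<in>{b..d}. f y \<noteq> h y})"
    by (intro card_mono) auto
  also have "\<dots> \<le> c + e"
    using card_Un_le[of "{y\<in>{a..b}. f y \<noteq> g y}" "{y\<in>{b..d}. f y \<noteq> h y}"] g(4) h(4) by linarith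
  finally have "card {y\<in>{a..d}. f y \<noteq> k y} \<le> c + e" .
  moreover have "k a = f a" "k d = f d" using g h assms(3,4) by (auto simp: k_def)
  moreover have "allowed_on F a d k"
    unfolding k_def using allowed_on_join g(2,3) h(1,3) by metis
  ultimately show ?thesis unfolding patchable_def by blast
qed

lemma patchable_all_interior:
  assumes "g a = f a" "g b = f b" "allowed_on F a b g" "a < b"
  shows "patchable F f a b (b - a)"
proof -
  \<comment> \<open>Leaving out the unchanged point \<open>a\<close> brings the
    \<open>b - a + 1\<close> points down to \<open>b - a\<close>.\<close>
  have "{y\<in>{a..b}. f y \<noteq> g y} \<subseteq> {a<..b}"
    using assms by (auto simp: order.order_iff_strict)
  then have "card {y\<in>{a..b}. f y \<noteq> g y} \<le> b - a"
    using card_mono[OF finite_greaterThanAtMost] by fastforce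
  then show ?thesis using assms unfolding patchable_def by blast
qed

section \<open>Bad intervals and the cost of repair\<close>

definition bad_starts :: "nat \<Rightarrow> (nat \<Rightarrow> real) set \<Rightarrow> (nat \<Rightarrow> real) \<Rightarrow> nat \<Rightarrow> nat set" where
  "bad_starts n P f i = {x. 1 \<le> x \<and> x + 2 ^ i \<le> n \<and> unrepairable n P {x, x + 2 ^ i} f}"

lemma bad_starts_subset: "bad_starts n P f i \<subseteq> {1..n}"
  by (auto simp: bad_starts_def)

lemma finite_bad_starts [simp]: "finite (bad_starts n P f i)"
  by (rule finite_subset[OF bad_starts_subset]) simp

text \<open>A bad dyadic interval of length \<open>2 ^ i\<close> is charged \<open>2 ^ Suc i\<close>, the length of its parent: the
  parent's interior is the largest set that has to be rewritten because of it.\<close>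

primrec repair_weight :: "nat \<Rightarrow> (nat \<Rightarrow> real) set \<Rightarrow> (nat \<Rightarrow> real) \<Rightarrow> nat \<Rightarrow> nat \<Rightarrow> nat" where
  "repair_weight n P f 0 x = 2 * of_bool (x \<in> bad_starts n P f 0)"
| "repair_weight n P f (Suc i) x = 2 ^ (i + 2) * of_bool (x \<in> bad_starts n P f (Suc i)) +
     repair_weight n P f i x + repair_weight n P f i (x + 2 ^ i)"

lemma repair_weight_bad: "x \<in> bad_starts n P f i \<Longrightarrow> 2 ^ Suc i \<le> repair_weight n P f i x"
  by (cases i) auto

lemma repair_weight_beyond: "n < x \<Longrightarrow> repair_weight n P f i x = 0"
  by (induction i arbitrary: x) (auto simp: bad_starts_def)

text \<open>A bad interval of length \<open>2 ^ j\<close> is a dyadic descendant for at most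
  \<open>2 ^ (i - j)\<close> starts \<open>x\<close> and costs \<open>2 ^ Suc j\<close> each time,
  hence at most \<open>2 ^ Suc i\<close> in total, whatever \<open>j\<close> is.\<close>

lemma sum_repair_weight:
  "(\<Sum>x=1..n. repair_weight n P f i x) \<le> 2 ^ Suc i * (\<Sum>j\<le>i. card (bad_starts n P f j))"
proof -
  have bad: "(\<Sum>x=1..n. of_bool (x \<in> bad_starts n P f i) :: nat) = card (bad_starts n P f i)" for i
    using bad_starts_subset[of n P f i] by (simp add: sum_of_bool_eq Int_absorb1 Int_commute)
  \<comment> \<open>Right children start at \<open>x + 2 ^ i\<close>, possibly beyond
    \<open>n\<close>, where the weight vanishes.\<close>
  have shift: "(\<Sum>x=1..n. repair_weight n P f i (x + d)) \<le> (\<Sum>x=1..n. repair_weight n P f i x)" for i d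
  proof -
    have "(\<Sum>x=1..n. repair_weight n P f i (x + d)) = (\<Sum>x=1+d..n+d. repair_weight n P f i x)"
      by (rule sum.shift_bounds_cl_nat_ivl[symmetric])
    also have "\<dots> \<le> (\<Sum>x=1..n+d. repair_weight n P f i x)"
      by (intro sum_mono2) auto
    also have "\<dots> = (\<Sum>x=1..n. repair_weight n P f i x)"
      by (intro sum.mono_neutral_right) (auto simp: repair_weight_beyond)
    finally show ?thesis .
  qed
  show ?thesis
  proof (induction i)
    case 0
    then show ?case using bad[of 0] by (simp flip: sum_distrib_left)
  next
    case (Suc i)
    have "(\<Sum>x=1..n. repair_weight n P f (Suc i) x) =
      2 ^ (i + 2) * card (bad_starts n P f (Suc i)) +
        (\<Sum>x=1..n. repair_weight n P f i x) + (\<Sum>x=1..n. repair_weight n P f i (x + 2 ^ i))"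
      by (simp only: repair_weight.simps sum.distrib bad flip: sum_distrib_left)
    also have "\<dots> \<le> 2 ^ (i + 2) * card (bad_starts n P f (Suc i)) + 2 * (\<Sum>x=1..n. repair_weight n P f i x)"
      using shift[of i "2 ^ i"] by linarith
    finally show ?case using Suc by (simp add: algebra_simps)
  qed
qed

section \<open>Repair of a sequence with few bad intervals\<close>

lemma local_propertyE:
  assumes "local_property n P"
  obtains F where "P \<subseteq> seqs n" "\<And>f. f \<in> seqs n \<Longrightarrow> f \<in> P \<longleftrightarrow> allowed_on F 1 n f"
proof -
  have "{1..n - 1} = {1..<n}" by auto
  then show ?thesis using assms that unfolding local_property_def allowed_on_def by metis
qed

text \<open>Induction on the level. With a bad child, the interior is taken from a repair of the
  whole interval; with two good children, their patches are glued.\<close>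

lemma patchable_if_repairable:
  assumes P: "P \<subseteq> seqs n" "\<And>f. f \<in> seqs n \<Longrightarrow> f \<in> P \<longleftrightarrow> allowed_on F 1 n f"
    and x: "1 \<le> x" "x + 2 ^ i \<le> n" "x \<notin> bad_starts n P f i"
  shows "patchable F f x (x + 2 ^ i) (repair_weight n P f i x)"
  using x
proof (induction i arbitrary: x)
  case (0 x)
  then obtain g where g: "g \<in> P" "g x = f x" "g (x + 1) = f (x + 1)"
    by (auto simp: bad_starts_def unrepairable_def)
  then have "allowed_on F 1 n g" using P by auto
  \<comment> \<open>A good interval of length 1 carries an allowed pair, so \<open>f\<close> itself
    is a patch without changes.\<close>
  then have "(f x, f (x + 1)) \<notin> F"
    using g 0 unfolding allowed_on_def by (metis atLeastLessThan_iff power_0 Suc_eq_plus1 Suc_le_eq)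
  then show ?case unfolding patchable_def allowed_on_def by (intro exI[of _ f]) auto
next
  case (Suc i x)
  show ?case
  proof (cases "x \<in> bad_starts n P f i \<or> x + 2 ^ i \<in> bad_starts n P f i")
    case True
    obtain g where g: "g \<in> P" "g x = f x" "g (x + 2 ^ Suc i) = f (x + 2 ^ Suc i)"
      using Suc.prems by (auto simp: bad_starts_def unrepairable_def)
    then have "allowed_on F 1 n g" using P by auto
    then have "allowed_on F x (x + 2 ^ Suc i) g"
      using Suc.prems unfolding allowed_on_def by auto
    then have "patchable F f x (x + 2 ^ Suc i) (2 ^ Suc i)"
      using patchable_all_interior[of g x f "x + 2 ^ Suc i" F] g by simp
    \<comment> \<open>The bad child's own charge is the length of its parent, which pays for the
      rewriting.\<close>
    moreover have "2 ^ Suc i \<le> repair_weight n P f (Suc i) x"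
      using True repair_weight_bad[of x n P f i] repair_weight_bad[of "x + 2 ^ i" n P f i] by auto
    ultimately show ?thesis using patchable_mono by blast
  next
    case False
    then have "patchable F f x (x + 2 ^ i) (repair_weight n P f i x)"
      "patchable F f (x + 2 ^ i) (x + 2 ^ i + 2 ^ i) (repair_weight n P f i (x + 2 ^ i))"
      using Suc.prems by (auto intro!: Suc.IH)
    from patchable_trans[OF this]
    have "patchable F f x (x + 2 ^ Suc i) (repair_weight n P f i x + repair_weight n P f i (x + 2 ^ i))"
      by (simp add: mult_2 add.assoc)
    then show ?thesis by (rule patchable_mono) simp
  qed
qed

lemma patchable_chain:
  assumes "P \<subseteq> seqs n" "\<And>f. f \<in> seqs n \<Longrightarrow> f \<in> P \<longleftrightarrow> allowed_on F 1 n f"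
    and "1 \<le> s" "s + k * 2 ^ l \<le> n" "\<And>m. m < k \<Longrightarrow> s + m * 2 ^ l \<notin> bad_starts n P f l"
  shows "patchable F f s (s + k * 2 ^ l) (\<Sum>m<k. repair_weight n P f l (s + m * 2 ^ l))"
  using assms(4,5)
proof (induction k)
  case 0
  then show ?case by (simp add: patchable_refl)
next
  case (Suc k)
  have "patchable F f s (s + k * 2 ^ l) (\<Sum>m<k. repair_weight n P f l (s + m * 2 ^ l))"
    using Suc by simp
  moreover have "patchable F f (s + k * 2 ^ l) (s + k * 2 ^ l + 2 ^ l) (repair_weight n P f l (s + k * 2 ^ l))"
    by (rule patchable_if_repairable[OF assms(1,2)]) (use assms(3) Suc.prems in \<open>auto simp: algebra_simps\<close>)
  ultimately have "patchable F f s (s + k * 2 ^ l + 2 ^ l)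
    ((\<Sum>m<k. repair_weight n P f l (s + m * 2 ^ l)) + repair_weight n P f l (s + k * 2 ^ l))"
    by (rule patchable_trans) auto
  then show ?case by (simp add: algebra_simps)
qed

text \<open>The end pieces \<open>{1..a}\<close> and \<open>{b..n}\<close> are taken from repairs \<open>u\<close>, \<open>v\<close> of the outermost
  intervals.\<close>

lemma patchable_extend:
  assumes P: "P \<subseteq> seqs n" "\<And>f. f \<in> seqs n \<Longrightarrow> f \<in> P \<longleftrightarrow> allowed_on F 1 n f"
    and "patchable F f a b c" "u \<in> P" "u a = f a" "v \<in> P" "v b = f b" "1 \<le> a" "a \<le> b" "b \<le> n"
  shows "\<exists>g\<in>P. card {y\<in>{1..n}. f y \<noteq> g y} \<le> c + (a - 1) + (n - b)"
proof -
  obtain h where h: "h a = f a" "h b = f b" "allowed_on F a b h" "card {y\<in>{a..b}. f y \<noteq> h y} \<le> c"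
    using assms(3) unfolding patchable_def by blast
  define h' where "h' = (\<lambda>y. if y \<le> a then u y else h y)"
  define g where "g = (\<lambda>y. if y \<le> b then h' y else v y)"
  have uv: "u \<in> seqs n" "v \<in> seqs n" "allowed_on F 1 n u" "allowed_on F 1 n v"
    using assms by auto
  then have uv': "allowed_on F 1 a u" "allowed_on F b n v"
    using assms unfolding allowed_on_def by auto
  have "allowed_on F 1 b h'"
    unfolding h'_def using allowed_on_join[OF uv'(1) h(3)] h(1) assms(5) by simp
  moreover have "h' b = v b" using assms h by (auto simp: h'_def)
  ultimately have "allowed_on F 1 n g"
    unfolding g_def using allowed_on_join[of F 1 b h' n v] uv'(2) by simp
  moreover have "g \<in> seqs n"
    using uv(1,2) assms(8-10) by (auto simp: g_def h'_def PiE_def extensional_def)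
  ultimately have "g \<in> P" using P by blast
  have "{y\<in>{1..n}. f y \<noteq> g y} \<subseteq> {y\<in>{a..b}. f y \<noteq> h y} \<union> {1..<a} \<union> {b<..n}"
    using assms(5) by (auto simp: g_def h'_def split: if_splits)
  then have "card {y\<in>{1..n}. f y \<noteq> g y} \<le> card ({y\<in>{a..b}. f y \<noteq> h y} \<union> {1..<a} \<union> {b<..n})"
    by (intro card_mono) auto
  also have "\<dots> \<le> card {y\<in>{a..b}. f y \<noteq> h y} + card {1..<a} + card {b<..n}"
    using card_Un_le[of "{y\<in>{a..b}. f y \<noteq> h y} \<union> {1..<a}" "{b<..n}"]
      card_Un_le[of "{y\<in>{a..b}. f y \<noteq> h y}" "{1..<a}"] by linarith
  also have "\<dots> \<le> c + (a - 1) + (n - b)" using h(4) by simp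
  finally show ?thesis using \<open>g \<in> P\<close> by blast
qed

text \<open>Averaging over the offset \<open>s\<close> of the dyadic partition: some offset has total weight below
  \<open>2 ^ Suc l\<close>, so in particular no interval of length \<open>2 ^ l\<close> is bad for it.\<close>

lemma repair_if_few_bad:
  assumes P: "P \<subseteq> seqs n" "\<And>f. f \<in> seqs n \<Longrightarrow> f \<in> P \<longleftrightarrow> allowed_on F 1 n f"
    and l: "2 * 2 ^ l \<le> n" and few: "(\<Sum>j\<le>l. card (bad_starts n P f j)) < 2 ^ l"
  shows "\<exists>g\<in>P. card {y\<in>{1..n}. f y \<noteq> g y} < 4 * 2 ^ l"
proof -
  let ?w = "repair_weight n P f l"
  let ?L = "2 ^ l :: nat"
  \<comment> \<open>\<open>k s\<close> counts the full intervals of length \<open>?L\<close> that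
    fit after offset \<open>s\<close>; \<open>U s\<close> is their total weight.\<close>
  define k where "k s = (n - s) div ?L" for s
  define U where "U s = (\<Sum>m<k s. ?w (s + m * ?L))" for s
  have ks: "s + k s * ?L \<le> n" "n < s + k s * ?L + ?L" "1 \<le> k s" if "s \<in> {1..?L}" for s
  proof -
    have "s \<le> n" using that l by auto
    have e: "n - s = k s * ?L + (n - s) mod ?L" unfolding k_def by (rule div_mult_mod_eq[symmetric])
    have m: "(n - s) mod ?L < ?L" by simp
    from e \<open>s \<le> n\<close> show "s + k s * ?L \<le> n" by linarith
    from e m \<open>s \<le> n\<close> show "n < s + k s * ?L + ?L" by linarith
    have "?L \<le> n - s" using that l by auto
    then show "1 \<le> k s" unfolding k_def by (simp add: div_greater_zero_iff Suc_le_eq)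
  qed
  \<comment> \<open>Distinct offsets have disjoint grids, so summing \<open>U\<close> over all
    offsets counts each start at most once.\<close>
  have inj: "inj_on (\<lambda>(s, m). s + m * ?L) (SIGMA s:{1..?L}. {..<k s})"
  proof (rule inj_onI, clarsimp)
    fix s m s' m' assume *: "s + m * ?L = s' + m' * ?L" "Suc 0 \<le> s" "s \<le> ?L" "Suc 0 \<le> s'" "s' \<le> ?L"
    \<comment> \<open>Offsets run from 1 to \<open>?L\<close>; subtracting 1 makes them remainders
      modulo \<open>?L\<close>.\<close>
    obtain t t' where t: "s = Suc t" "s' = Suc t'" "t < ?L" "t' < ?L"
      using * by (metis Suc_le_D Suc_le_eq)
    then have "(t + m * ?L) div ?L = (t' + m' * ?L) div ?L" using * by simp
    then have "m = m'" using t(3,4) by simp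
    then show "s = s' \<and> m = m'" using * by simp
  qed
  have "(\<Sum>s=1..?L. U s) = (\<Sum>(s, m)\<in>(SIGMA s:{1..?L}. {..<k s}). ?w (s + m * ?L))"
    unfolding U_def by (rule sum.Sigma) auto
  also have "\<dots> = sum ?w ((\<lambda>(s, m). s + m * ?L) ` (SIGMA s:{1..?L}. {..<k s}))"
    using sum.reindex[OF inj, of ?w] by (simp add: case_prod_unfold)
  also have "\<dots> \<le> (\<Sum>x=1..n. ?w x)"
  proof (rule sum_mono2)
    show "(\<lambda>(s, m). s + m * ?L) ` (SIGMA s:{1..?L}. {..<k s}) \<subseteq> {1..n}"
    proof clarsimp
      fix s m assume "Suc 0 \<le> s" "s \<le> ?L" "m < k s"
      then have "s + m * ?L \<le> s + k s * ?L" by simp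
      also have "\<dots> \<le> n" using ks(1)[of s] \<open>Suc 0 \<le> s\<close> \<open>s \<le> ?L\<close> by simp
      finally show "s + m * ?L \<le> n" .
    qed
  qed auto
  also have "\<dots> \<le> 2 ^ Suc l * (\<Sum>j\<le>l. card (bad_starts n P f j))"
    by (rule sum_repair_weight)
  also have "\<dots> < 2 ^ Suc l * ?L" using few by (intro mult_strict_left_mono) auto
  also have "\<dots> = (\<Sum>s=1..?L. 2 ^ Suc l)" by simp
  finally have "(\<Sum>s=1..?L. U s) < (\<Sum>s=1..?L. 2 ^ Suc l)" .
  then have "\<exists>s\<in>{1..?L}. U s < 2 ^ Suc l"
    using sum_mono[of "{1..?L}" "\<lambda>_. 2 ^ Suc l" U] by (force simp: not_less)
  then obtain s where s: "s \<in> {1..?L}" "U s < 2 ^ Suc l" by blast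
  \<comment> \<open>A single bad top interval would already contribute \<open>2 ^ Suc l\<close> to
    \<open>U s\<close>.\<close>
  have nb: "s + m * ?L \<notin> bad_starts n P f l" if "m < k s" for m
  proof
    assume "s + m * ?L \<in> bad_starts n P f l"
    then have "2 ^ Suc l \<le> ?w (s + m * ?L)" by (rule repair_weight_bad)
    also have "\<dots> \<le> U s" unfolding U_def using that
      by (intro member_le_sum[of m "{..<k s}" "\<lambda>m. ?w (s + m * ?L)"]) auto
    finally show False using s by simp
  qed
  define b where "b = s + k s * ?L"
  obtain k' where k': "k s = Suc k'" using ks(3)[OF s(1)] by (cases "k s") auto
  have b: "b = s + k' * ?L + ?L" "b \<le> n" "s \<le> b" "n < b + ?L" and s1: "1 \<le> s"
    using ks[OF s(1)] s(1) by (auto simp: b_def k')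
  have "s + ?L \<le> n" using b by simp
  then obtain u where u: "u \<in> P" "u s = f s"
    using nb[of 0] s1 by (auto simp: k' bad_starts_def unrepairable_def)
  obtain v where v: "v \<in> P" "v b = f b"
    using nb[of k'] s1 b(1,2) by (auto simp: k' bad_starts_def unrepairable_def)
  have "patchable F f s b (U s)"
    unfolding b_def U_def by (rule patchable_chain[OF P]) (use s1 ks(1)[OF s(1)] nb in auto)
  from patchable_extend[OF P this u v s1 b(3,2)]
  obtain g where "g \<in> P" "card {y\<in>{1..n}. f y \<noteq> g y} \<le> U s + (s - 1) + (n - b)" by blast
  \<comment> \<open>The weight is below \<open>2 * ?L\<close>, and each end piece adds fewer than
    \<open>?L\<close>.\<close>
  moreover have "U s + (s - 1) + (n - b) < 4 * ?L" using s b(4) by auto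
  ultimately show ?thesis by (meson le_less_trans)
qed

section \<open>Verdict and queries of the decision tree\<close>

lemma accepts_pair_tester_tree:
  "accepts (pair_tester_tree n P ps rej) f \<longleftrightarrow>
     \<not> rej \<and> (\<forall>(x, y)\<in>set ps. \<not> unrepairable n P {x, y} f)"
proof (induction ps arbitrary: rej)
  case (Cons p ps)
  obtain x y where p: "p = (x, y)" by (cases p)
  have "unrepairable n P {x, y} (undefined(x := f x, y := f y)) = unrepairable n P {x, y} f"
    by (auto simp: unrepairable_def)
  then show ?case using Cons by (auto simp: p)
qed simp

text \<open>The input \<open>f\<close> does not occur on the right, which yields
  nonadaptivity.\<close>

lemma queries_pair_tester_tree:
  "queries (pair_tester_tree n P ps rej) f = concat (map (\<lambda>(x, y). [x, y]) ps)"
  by (induction ps arbitrary: rej) (auto simp: case_prod_unfold)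

section \<open>Uniform cyclic pairs and independent sampling\<close>

lemma cyc_pairs_subset: "cyc_pairs d n \<subseteq> {1..n} \<times> {1..n}"
  by (auto simp: cyc_pairs_def)

lemma finite_cyc_pairs [simp]: "finite (cyc_pairs d n)"
  by (rule finite_subset[OF cyc_pairs_subset]) simp

lemma cyc_pairs_nonempty: "n > 0 \<Longrightarrow> cyc_pairs d n \<noteq> {}"
proof -
  assume "n > 0"
  then have "(1, d mod n + 1) \<in> cyc_pairs d n"
    by (auto simp: cyc_pairs_def Suc_le_eq zmod_int)
  then show ?thesis by blast
qed

text \<open>\<open>x\<close> fixes \<open>y\<close> modulo \<open>n\<close>, and congruent elements
  of \<open>{1..n}\<close> coincide. This upper bound on the size bounds uniform probabilities from
  below.\<close>

lemma card_cyc_pairs_le: "card (cyc_pairs d n) \<le> n"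
proof -
  have "inj_on fst (cyc_pairs d n)"
  proof (rule inj_onI)
    fix p q assume "p \<in> cyc_pairs d n" "q \<in> cyc_pairs d n" "fst p = fst q"
    then obtain x y y' where *: "p = (x, y)" "q = (x, y')" "y \<in> {1..n}" "y' \<in> {1..n}"
      "(int y - int x) mod int n = (int y' - int x) mod int n"
      by (auto simp: cyc_pairs_def)
    then have "int n dvd (int y - int x) - (int y' - int x)" by (meson mod_eq_dvd_iff)
    then have "int n dvd int y - int y'" by simp
    moreover have "\<bar>int y - int y'\<bar> < int n" using * by auto
    ultimately have "y = y'" using dvd_imp_le_int[of "int y - int y'" "int n"] by linarith
    then show "p = q" using * by simp
  qed
  moreover have "fst ` cyc_pairs d n \<subseteq> {1..n}" by (auto simp: cyc_pairs_def)
  ultimately show ?thesis using card_inj_on_le[of fst "cyc_pairs d n" "{1..n}"] by simp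
qed

lemma set_sample_pair: "n > 0 \<Longrightarrow> set_pmf (sample_pair \<epsilon> n) \<subseteq> {1..n} \<times> {1..n}"
  using cyc_pairs_subset by (simp add: sample_pair_def cyc_pairs_nonempty UN_least)

lemma prob_bind_pmf_of_set:
  assumes "S \<noteq> {}" "finite S"
  shows "measure_pmf.prob (pmf_of_set S \<bind> g) A = (\<Sum>i\<in>S. measure_pmf.prob (g i) A) / card S"
proof -
  \<comment> \<open>Turns the event \<open>A\<close> into the point \<open>True\<close> of a Boolean
    distribution, so that a rule for point masses applies.\<close>
  have indicator: "measure_pmf.prob M A = pmf (map_pmf (\<lambda>x. x \<in> A) M) True" for M
    by (simp add: pmf_map vimage_def)
  show ?thesis unfolding indicator map_bind_pmf by (rule pmf_bind_pmf_of_set[OF assms])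
qed

lemma prob_replicate_pmf_all:
  fixes M :: "'a :: countable pmf"
  shows "measure_pmf.prob (replicate_pmf k M) {xs. set xs \<subseteq> A} = measure_pmf.prob M A ^ k"
proof (induction k)
  case 0
  then show ?case by (simp add: indicator_def)
next
  case (Suc k)
  \<comment> \<open>Splitting off the first draw as an independent factor turns the event into a
    product set.\<close>
  have "replicate_pmf (Suc k) M = map_pmf (\<lambda>(x, xs). x # xs) (pair_pmf M (replicate_pmf k M))"
    by (simp add: pair_pmf_def map_pmf_def bind_assoc_pmf bind_return_pmf)
  moreover have "(\<lambda>(x, xs). x # xs) -` {xs. set xs \<subseteq> A} = A \<times> {xs. set xs \<subseteq> A}"
    by auto
  ultimately show ?case
    using Suc by (simp add: measure_pmf_prob_product del: replicate_pmf.simps)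
qed

lemma prob_sample_pair_ge:
  assumes "n > 0"
  shows "(\<Sum>i\<le>pair_tester_levels \<epsilon> n. real (card (cyc_pairs (2 ^ i) n \<inter> A)))
      / ((pair_tester_levels \<epsilon> n + 1) * n) \<le> measure_pmf.prob (sample_pair \<epsilon> n) A"
proof -
  let ?l = "pair_tester_levels \<epsilon> n"
  have level: "real (card (cyc_pairs d n \<inter> A)) / n \<le> measure_pmf.prob (pmf_of_set (cyc_pairs d n)) A" for d
  proof -
    have "0 < card (cyc_pairs d n)"
      using cyc_pairs_nonempty[OF assms] by (simp add: card_gt_0_iff)
    then show ?thesis
      using card_cyc_pairs_le[of d n] cyc_pairs_nonempty[OF assms, of d]
      by (simp add: measure_pmf_of_set frac_le)
  qed
  have "(\<Sum>i\<le>?l. real (card (cyc_pairs (2 ^ i) n \<inter> A))) / ((?l + 1) * n)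
      = (\<Sum>i\<le>?l. real (card (cyc_pairs (2 ^ i) n \<inter> A)) / n) / (?l + 1)"
    by (simp add: algebra_simps flip: sum_divide_distrib)
  also have "\<dots> \<le> (\<Sum>i\<le>?l. measure_pmf.prob (pmf_of_set (cyc_pairs (2 ^ i) n)) A) / (?l + 1)"
    by (intro divide_right_mono sum_mono level) simp
  also have "\<dots> = measure_pmf.prob (sample_pair \<epsilon> n) A"
    unfolding sample_pair_def by (simp add: prob_bind_pmf_of_set atLeast0AtMost)
  finally show ?thesis .
qed

section \<open>Detection probability of one iteration\<close>

text \<open>Bad intervals inject into the cyclic pairs via their end points; unrepairable pairs that
  wrap around only enlarge the right side.\<close>

lemma card_bad_starts_le:
  "card (bad_starts n P f i) \<le> card (cyc_pairs (2 ^ i) n \<inter> {(x, y). unrepairable n P {x, y} f})"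
proof (rule card_inj_on_le[of "\<lambda>x. (x, x + 2 ^ i)"])
  show "(\<lambda>x. (x, x + 2 ^ i)) ` bad_starts n P f i
      \<subseteq> cyc_pairs (2 ^ i) n \<inter> {(x, y). unrepairable n P {x, y} f}"
    by (auto simp: bad_starts_def cyc_pairs_def)
qed (auto simp: inj_on_def)

lemma pair_tester_levels_bounds:
  assumes "\<epsilon> * real n \<ge> 4"
  shows "real (pair_tester_levels \<epsilon> n) + 2 \<le> log 2 (\<epsilon> * n)"
    and "4 * 2 ^ pair_tester_levels \<epsilon> n \<le> \<epsilon> * n"
    and "\<epsilon> * n < 8 * 2 ^ pair_tester_levels \<epsilon> n"
proof -
  let ?l = "pair_tester_levels \<epsilon> n"
  have "log 2 4 = (2 :: real)" using log_pow_cancel[of 2 2] by simp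
  then have q: "log 2 (\<epsilon> * n / 4) = log 2 (\<epsilon> * n) - 2" using assms by (subst log_divide) auto
  \<comment> \<open>Ensures that \<open>nat\<close> truncates nothing in the number of
    levels.\<close>
  have nonneg: "0 \<le> log 2 (\<epsilon> * n / 4)" using assms by simp
  then have l: "real ?l \<le> log 2 (\<epsilon> * n / 4)" "log 2 (\<epsilon> * n / 4) < real ?l + 1"
    unfolding pair_tester_levels_def by linarith+
  show "real ?l + 2 \<le> log 2 (\<epsilon> * n)" using l q by simp
  have "2 powr real ?l \<le> \<epsilon> * n / 4" using l(1) assms by (simp add: le_log_iff)
  then show "4 * 2 ^ ?l \<le> \<epsilon> * n" by (simp add: powr_realpow)
  have "\<epsilon> * n / 4 < 2 powr (real ?l + 1)" using l(2) assms by (simp add: log_less_iff)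
  then show "\<epsilon> * n < 8 * 2 ^ ?l" by (simp add: powr_add powr_realpow)
qed

lemma prob_sample_pair_far:
  assumes "0 < \<epsilon>" "\<epsilon> < 1" "\<epsilon> * real n \<ge> 4" "local_property n P" "eps_far n \<epsilon> P f"
  shows "\<epsilon> / (8 * log 2 (\<epsilon> * n))
    \<le> measure_pmf.prob (sample_pair \<epsilon> n) {(x, y). unrepairable n P {x, y} f}"
proof -
  let ?l = "pair_tester_levels \<epsilon> n" and ?bad = "{(x, y). unrepairable n P {x, y} f}"
  note l = pair_tester_levels_bounds[OF assms(3)]
  have n: "n > 0" using assms(3) by (cases n) auto
  obtain F where P: "P \<subseteq> seqs n" "\<And>f. f \<in> seqs n \<Longrightarrow> f \<in> P \<longleftrightarrow> allowed_on F 1 n f"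
    using local_propertyE[OF assms(4)] by blast
  have "\<epsilon> * n \<le> n" using assms(2) by (intro mult_left_le_one_le) (use assms(1) in auto)
  then have "real (2 * 2 ^ ?l) \<le> real n" using l(2) by simp
  then have ln: "2 * 2 ^ ?l \<le> n" by (simp only: of_nat_le_iff)
  have "2 ^ ?l \<le> (\<Sum>j\<le>?l. card (bad_starts n P f j))"
  proof (rule ccontr)
    assume "\<not> ?thesis"
    then obtain g where g: "g \<in> P" "card {y\<in>{1..n}. f y \<noteq> g y} < 4 * 2 ^ ?l"
      using repair_if_few_bad[OF P ln, of f] by auto
    from g(2) have "real (card {y\<in>{1..n}. f y \<noteq> g y}) < real (4 * 2 ^ ?l)"
      by (simp only: of_nat_less_iff)
    also have "\<dots> \<le> \<epsilon> * n" using l(2) by simp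
    finally show False using assms(5) g(1) unfolding eps_far_def by (meson not_le)
  qed
  also have "\<dots> \<le> (\<Sum>j\<le>?l. card (cyc_pairs (2 ^ j) n \<inter> ?bad))"
    by (intro sum_mono card_bad_starts_le)
  finally have "real (2 ^ ?l) \<le> (\<Sum>j\<le>?l. real (card (cyc_pairs (2 ^ j) n \<inter> ?bad)))"
    by (simp only: flip: of_nat_sum of_nat_le_iff)
  then have B: "\<epsilon> * n / 8 \<le> (\<Sum>j\<le>?l. real (card (cyc_pairs (2 ^ j) n \<inter> ?bad)))"
    using l(3) by simp
  \<comment> \<open>The number of levels, \<open>?l + 1\<close>, is at most
    \<open>log 2 (\<epsilon> * n)\<close>.\<close>
  have "\<epsilon> / (8 * log 2 (\<epsilon> * n)) \<le> \<epsilon> / (8 * (real ?l + 1))"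
    using l(1) assms(1) by (intro frac_le) auto
  also have "\<dots> = (\<epsilon> * n / 8) / ((?l + 1) * n)"
    using n nonzero_mult_divide_mult_cancel_right[of "real n" \<epsilon> "8 * (real ?l + 1)"]
    by (simp add: algebra_simps)
  also have "\<dots> \<le> (\<Sum>j\<le>?l. real (card (cyc_pairs (2 ^ j) n \<inter> ?bad))) / ((?l + 1) * n)"
    by (intro divide_right_mono B) simp
  also have "\<dots> \<le> measure_pmf.prob (sample_pair \<epsilon> n) ?bad"
    by (rule prob_sample_pair_ge[OF n])
  finally show ?thesis .
qed

section \<open>Amplification over the rounds\<close>

text \<open>\<open>L\<close> stands for \<open>log 2 (\<epsilon> * n)\<close>. The constants 8 and
  200 give \<open>p * k \<ge> 25\<close>; then \<open>(1 - p) ^ k \<le> exp (- (p * k))\<close>, and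
  \<open>exp x \<ge> 1 + x\<close> already exceeds 7 at \<open>x = p * k\<close>.\<close>

lemma power_failure_le:
  fixes p :: real
  assumes "0 < \<epsilon>" "1 < L" "\<epsilon> / (8 * L) \<le> p" "p \<le> 1" "200 * L / \<epsilon> \<le> real k"
  shows "(1 - p) ^ k \<le> 1 / 7"
proof -
  have p: "0 < p" using assms(1-3) by (smt (verit) divide_pos_pos)
  have "25 = \<epsilon> / (8 * L) * (200 * L / \<epsilon>)" using assms(1,2) by (simp add: field_simps)
  also have "\<dots> \<le> p * real k" using assms p by (intro mult_mono) auto
  finally have pk: "25 \<le> p * real k" .
  have "(1 - p) ^ k \<le> exp (- p) ^ k"
    using assms(4) exp_ge_add_one_self[of "- p"] by (intro power_mono) auto
  also have "\<dots> = inverse (exp (p * real k))"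
    by (simp add: exp_of_nat_mult[symmetric] exp_minus[symmetric] mult.commute)
  also have "\<dots> \<le> inverse 7"
  proof (rule le_imp_inverse_le)
    show "7 \<le> exp (p * real k)" using exp_ge_add_one_self[of "p * real k"] pk by linarith
  qed simp
  finally show ?thesis by (simp add: inverse_eq_divide)
qed

lemma set_pair_tester:
  assumes "n > 0" "t \<in> set_pmf (pair_tester n P \<epsilon>)"
  obtains ps where "t = pair_tester_tree n P ps False" "set ps \<subseteq> {1..n} \<times> {1..n}"
  using assms set_sample_pair[OF assms(1), of \<epsilon>]
  by (auto simp: pair_tester_def set_replicate_pmf in_lists_conv_set subset_iff)

theorem lemma6p2:
  fixes \<epsilon> :: real and n :: nat and P :: "(nat \<Rightarrow> real) set"
  assumes "0 < \<epsilon>" and "\<epsilon> < 1"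
    and "\<epsilon> * real n \<ge> 4"
    and "local_property n P"
  shows "nonadaptive n (pair_tester n P \<epsilon>) \<and>
         one_sided_tester n \<epsilon> (1 / 7) P (pair_tester n P \<epsilon>)"
proof
  have n: "n > 0" using assms(3) by (cases n) auto
  have P: "P \<subseteq> seqs n" using assms(4) by (simp add: local_property_def)
  show "nonadaptive n (pair_tester n P \<epsilon>)"
    unfolding nonadaptive_def by (metis set_pair_tester[OF n] queries_pair_tester_tree)
  have "set (queries t f) \<subseteq> {1..n}" if t: "t \<in> set_pmf (pair_tester n P \<epsilon>)" for t f
    using n t
  proof (rule set_pair_tester)
    fix ps assume "t = pair_tester_tree n P ps False" "set ps \<subseteq> {1..n} \<times> {1..n}"
    then show ?thesis by (auto simp: queries_pair_tester_tree)
  qed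
  moreover have "accepts t f" if f: "f \<in> P" and t: "t \<in> set_pmf (pair_tester n P \<epsilon>)" for t f
    using n t
  proof (rule set_pair_tester)
    fix ps assume "t = pair_tester_tree n P ps False"
    \<comment> \<open>\<open>f\<close> is its own repair on every set.\<close>
    moreover have "\<not> unrepairable n P S f" for S
      using f P unfolding unrepairable_def by blast
    ultimately show ?thesis by (simp add: accepts_pair_tester_tree case_prod_unfold)
  qed
  moreover have "1 - 1 / 7 \<le> measure_pmf.prob (pair_tester n P \<epsilon>) {t. \<not> accepts t f}"
    if far: "eps_far n \<epsilon> P f" for f
  proof -
    let ?bad = "{(x, y). unrepairable n P {x, y} f}" and ?M = "sample_pair \<epsilon> n"
    \<comment> \<open>Acceptance means that every sampled pair avoids \<open>?bad\<close>;
      independence then turns it into a power.\<close>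
    have "measure_pmf.prob (pair_tester n P \<epsilon>) {t. accepts t f} =
        measure_pmf.prob (replicate_pmf (pair_tester_rounds \<epsilon> n) ?M) {ps. set ps \<subseteq> - ?bad}"
      by (auto simp: pair_tester_def accepts_pair_tester_tree intro!: arg_cong2[where f = measure])
    also have "\<dots> = (1 - measure_pmf.prob ?M ?bad) ^ pair_tester_rounds \<epsilon> n"
      using measure_pmf.prob_compl[of ?bad ?M]
      by (simp add: prob_replicate_pmf_all Compl_eq_Diff_UNIV)
    also have "\<dots> \<le> 1 / 7"
    proof (rule power_failure_le)
      show "1 < log 2 (\<epsilon> * n)"
        using pair_tester_levels_bounds(1)[OF assms(3)] by linarith
      show "200 * log 2 (\<epsilon> * n) / \<epsilon> \<le> real (pair_tester_rounds \<epsilon> n)"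
        unfolding pair_tester_rounds_def by linarith
    qed (use assms prob_sample_pair_far[OF assms far] in auto)
    finally have "measure_pmf.prob (pair_tester n P \<epsilon>) {t. accepts t f} \<le> 1 / 7" .
    moreover have "{t. \<not> accepts t f} = UNIV - {t. accepts t f}" by auto
    ultimately show ?thesis
      using measure_pmf.prob_compl[of "{t. accepts t f}" "pair_tester n P \<epsilon>"] by simp
  qed
  ultimately show "one_sided_tester n \<epsilon> (1 / 7) P (pair_tester n P \<epsilon>)"
    unfolding one_sided_tester_def by blast
qed

end
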